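(* Let $Q$ be the true $m\times k$ $Q$-matrix. Assume: (C1) $Q$ is complete; (C2) the $T$-matrices $T(\cdot)$ are saturated; (C3) $\mathbf A_1,\ldots,\mathbf A_N$ are i.i.d. random vectors in $\{0,1\}^k$ with $P(\mathbf A_r=\mathbf A)=p^*_{\mathbf A}$ for all $\mathbf A\in\{0,1\}^k$; (C4) $p^*_{\mathbf A}>0$ for every $\mathbf A\in\{0,1\}^k$ (including $\mathbf A=\mathbf 0$); (C5) each attribute is required by at least two items, i.e. every column of $Q$ contains at least two entries equal to $1$. Suppose that for subject $r$ the response to item $i$ is $$R_r^i=\xi_r^i=\prod_{j=1}^k (A_r^j)^{Q_{ij}},\qquad i=1,\ldots,m.$$ Let $\hat Q$ be a minimizer of $S(Q')$ over all candidate $m\times k$ $Q$-matrices $Q'$. Then $$\lim_{N\to\infty}P(\hat Q\sim Q)=1 .$$ Further, let $\tilde{\mathbf p}=\arg\inf_{\mathbf p}|T(\hat Q)\mathbf p-\alpha|^2$. Then, with an appropriate rearrangement of the columns of $\hat Q$ (one for which $\hat Q=Q$ whenever $\hat Q\sim Q$), for any $\varepsilon>0$, $$\lim_{N\to\infty}P(|\tilde{\mathbf p}-\mathbf p^*|\le\varepsilon)=1,$$ where $\mathbf p^*=(p^*_{\mathbf A}:\mathbf A\in\{0,1\}^k\setminus\{\mathbf 0\})$.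
   Context: There are $m$ items and $k$ attributes, with $m,k$ known. A $Q$-matrix is an $m\times k$ binary matrix with no zero row (every item requires at least one attribute); $Q_{ij}=1$ means that item $i$ requires attribute $j$. Subject $r$ ($r=1,\ldots,N$) has an unobserved attribute vector $\mathbf A_r=(A_r^1,\ldots,A_r^k)^\top\in\{0,1\}^k$ and an observed response vector $\mathbf R_r=(R_r^1,\ldots,R_r^m)^\top\in\{0,1\}^m$. Convention: $0^0=1$. $T$-matrix: for a $Q$-matrix $Q'$, the columns of $T(Q')$ are indexed by $\mathbf A\in\{0,1\}^k\setminus\{\mathbf 0\}$, and its rows by combinations $I_{i_1}\wedge\cdots\wedge I_{i_l}$ of distinct items ($I_i$ stands for a positive response to item $i$). The entry in row $I_{i_1}\wedge\cdots\wedge I_{i_l}$ and column $\mathbf A$ is $\prod_{h=1}^l\prod_{j=1}^k (A^j)^{Q'_{i_h j}}$. $T$ is saturated if all combinations $I_{i_1}\wedge\cdots\wedge I_{i_l}$, $l=1,\ldots,m$, are included, so that it has $2^m-1$ rows. $\alpha$ is the column vector indexed like the rows of $T$, whose entry for $I_{i_1}\wedge\cdots\wedge I_{i_l}$ is $\frac1N\#\{r: R_r^{i_1}=\cdots=R_r^{i_l}=1\}$. $S(Q')=\inf_{\mathbf p}|T(Q')\mathbf p-\alpha|$, with $|\cdot|$ the Euclidean norm and the infimum over $\mathbf p=(p_{\mathbf A}:\mathbf A\ne\mathbf 0)\in[0,1]^{2^k-1}$ with $\sum_{\mathbf A\neq\mathbf 0}p_{\mathbf A}\in[0,1]$. The infimum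 defining $\tilde{\mathbf p}$ is over the same set of $\mathbf p$. Minimizers need not be unique; "$\arg\inf$" denotes any minimizer. $Q\sim Q'$ means that $Q$ and $Q'$ have identical column vectors, possibly arranged in different orders (they differ by a column permutation). $Q$ is complete if each $e_i^\top$, $i=1,\ldots,k$ (standard basis vectors of $\mathbb R^k$), is a row of $Q$. *)

theory Defs
  imports "HOL-Probability.Probability"
begin

text \<open>
  Items are indexed by the finite type \<open>'m\<close> and attributes by the finite type \<open>'k\<close>. Binary vectors
  and matrices have entries in the natural numbers, restricted to \<open>{0, 1}\<close>, so that the power
  \<open>a ^ q\<close> satisfies the convention \<open>0 ^ 0 = 1\<close>.
\<close>

definition binary_vectors :: "(nat ^ 'k) set" where
  "binary_vectors = {a. \<forall>j. a $ j \<in> {0, 1}}"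

definition nonzero_attributes :: "(nat ^ 'k) set" where
  "nonzero_attributes = binary_vectors - {0}"

definition Q_matrix :: "nat ^ 'k ^ 'm \<Rightarrow> bool" where
  "Q_matrix Q \<longleftrightarrow> (\<forall>i. row i Q \<in> binary_vectors \<and> row i Q \<noteq> 0)"

definition complete_Q :: "nat ^ 'k ^ 'm \<Rightarrow> bool" where
  "complete_Q Q \<longleftrightarrow> (\<forall>j. axis j 1 \<in> rows Q)"

definition col_equiv :: "nat ^ 'k ^ 'm \<Rightarrow> nat ^ 'k ^ 'm \<Rightarrow> bool" (infix "\<sim>\<^sub>Q" 50) where
  "Q \<sim>\<^sub>Q Q' \<longleftrightarrow> (\<exists>\<pi>. bij \<pi> \<and> (\<forall>j. column j Q = column (\<pi> j) Q'))"

definition ideal_response :: "nat ^ 'k ^ 'm \<Rightarrow> nat ^ 'k \<Rightarrow> nat ^ 'm" where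
  "ideal_response Q a = (\<chi> i. \<Prod>j\<in>UNIV. (a $ j) ^ (Q $ i $ j))"

text \<open>
  A combination of distinct items is the set of the items occurring in it. Throughout, \<open>C\<close> is the
  set of combinations that index the rows of the \<open>T\<close>-matrix.
\<close>

definition saturated :: "'m set set \<Rightarrow> bool" where
  "saturated C \<longleftrightarrow> C = {I. I \<noteq> {}}"

definition T_entry :: "nat ^ 'k ^ 'm \<Rightarrow> 'm set \<Rightarrow> nat ^ 'k \<Rightarrow> real" where
  "T_entry Q I a = real (\<Prod>i\<in>I. ideal_response Q a $ i)"

definition T_mult :: "nat ^ 'k ^ 'm \<Rightarrow> (nat ^ 'k \<Rightarrow> real) \<Rightarrow> 'm set \<Rightarrow> real" where
  "T_mult Q p I = (\<Sum>a\<in>nonzero_attributes. T_entry Q I a * p a)"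

definition alpha :: "nat \<Rightarrow> (nat \<Rightarrow> nat ^ 'm) \<Rightarrow> 'm set \<Rightarrow> real" where
  "alpha N R I = real (card {r \<in> {1..N}. \<forall>i\<in>I. R r $ i = 1}) / real N"

text \<open>
  Vectors \<open>p\<close> indexed by the nonzero attribute vectors are functions of which only the values on
  \<open>nonzero_attributes\<close> matter.
\<close>

definition sub_probabilities :: "(nat ^ 'k \<Rightarrow> real) set" where
  "sub_probabilities =
     {p \<in> nonzero_attributes \<rightarrow> {0..1}. (\<Sum>a\<in>nonzero_attributes. p a) \<in> {0..1}}"

definition residual ::
  "'m set set \<Rightarrow> ('m set \<Rightarrow> real) \<Rightarrow> nat ^ 'k ^ 'm \<Rightarrow> (nat ^ 'k \<Rightarrow> real) \<Rightarrow> real" where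
  "residual C al Q p = L2_set (\<lambda>I. T_mult Q p I - al I) C"

definition S :: "'m set set \<Rightarrow> ('m set \<Rightarrow> real) \<Rightarrow> nat ^ 'k ^ 'm \<Rightarrow> real" where
  "S C al Q = (INF p\<in>sub_probabilities. residual C al Q p)"

end

theory Submission
  imports Defs "HOL-Real_Asymp.Real_Asymp"
begin

text \<open>
  Without slipping or guessing, a subject with attribute vector \<open>a\<close> answers correctly exactly the
  items of a set \<open>mastered Q a\<close>, and the saturated \<open>T\<close>-matrix records the distribution of this set:
  \<open>T_entry Q I a\<close> is the indicator of \<open>I \<subseteq> mastered Q a\<close>. Inclusion-exclusion therefore recovers
  from \<open>T(Q) p\<close> the total weight that \<open>p\<close> puts on the attribute vectors with a given nonempty set of
  mastered items. This inversion is bounded, which gives the estimate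
  \<open>mastered_weight_diff_le\<close>.

  The empirical frequencies \<open>p\<close> of the attribute vectors satisfy \<open>T(Q) p = \<alpha>\<close>, so the minimum of
  \<open>S\<close> is 0. When every attribute vector has been observed, an estimate with \<open>S = 0\<close> must be able to
  produce every set of mastered items that \<open>Q\<close> produces. A complete \<open>Q\<close> produces the largest possible
  number \<open>2\<^sup>k\<close> of such sets, so both matrices produce the same family of sets. The complements of
  these sets are the unions of columns, where a column is regarded as the set of its items; as every
  column of a complete matrix contains an item that lies in no other column, the \<open>k\<close> columns
  are determined by the family (\<open>col_equiv_if_mastered_subset\<close>). Moreover distinct attribute vectors
  have distinct sets of mastered items under \<open>Q\<close>, so that the minimizer of the residual for \<open>Q\<close> is
  the vector of empirical frequencies.

  Hence both assertions hold on the event that all empirical frequencies are close to their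
  probabilities. By Hoeffding's inequality the probability of this event tends to 1.
\<close>

section \<open>Sets of mastered items\<close>

text \<open>The set of items that a subject with attribute vector \<open>a\<close> answers correctly.\<close>

definition mastered :: "nat ^ 'k ^ 'm \<Rightarrow> nat ^ 'k \<Rightarrow> 'm set" where
  "mastered Q a = {i. ideal_response Q a $ i = 1}"

text \<open>The \<open>j\<close>-th column of a binary matrix, regarded as the set of the items that require \<open>j\<close>.\<close>

definition requiring :: "nat ^ 'k ^ 'm \<Rightarrow> 'k \<Rightarrow> 'm set" where
  "requiring Q j = {i. Q $ i $ j = 1}"

lemma Q_matrix_entry: "Q_matrix Q \<Longrightarrow> Q $ i $ j = 0 \<or> Q $ i $ j = 1"
  by (auto simp: Q_matrix_def binary_vectors_def row_def)

lemma finite_binary_vectors: "finite (binary_vectors :: (nat ^ 'k) set)"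
proof (rule finite_imageD)
  show "inj_on (\<lambda>a. {j. a $ j = 1}) (binary_vectors :: (nat ^ 'k) set)"
  proof (rule inj_onI)
    fix a b :: "nat ^ 'k"
    assume ab: "a \<in> binary_vectors" "b \<in> binary_vectors" and eq: "{j. a $ j = 1} = {j. b $ j = 1}"
    have "a $ j = b $ j" for j
    proof -
      have "a $ j \<in> {0, 1}" "b $ j \<in> {0, 1}"
        using ab unfolding binary_vectors_def by blast+
      moreover have "a $ j = 1 \<longleftrightarrow> b $ j = 1"
        using eq by blast
      ultimately show ?thesis by auto
    qed
    then show "a = b" by (simp add: vec_eq_iff)
  qed
qed simp

lemma finite_nonzero_attributes: "finite (nonzero_attributes :: (nat ^ 'k) set)"
  unfolding nonzero_attributes_def using finite_binary_vectors by blast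

lemma ideal_response_eq:
  assumes "Q_matrix Q" "a \<in> binary_vectors"
  shows "ideal_response Q a $ i = of_bool (\<forall>j. i \<in> requiring Q j \<longrightarrow> a $ j = 1)"
proof -
  have bin: "a $ j = 0 \<or> a $ j = 1" for j
    using assms(2) by (auto simp: binary_vectors_def)
  have factor: "(a $ j) ^ (Q $ i $ j) = of_bool (i \<in> requiring Q j \<longrightarrow> a $ j = 1)" for j
    using bin[of j] Q_matrix_entry[OF assms(1), of i j] by (auto simp: requiring_def)
  show ?thesis
  proof (cases "\<forall>j. i \<in> requiring Q j \<longrightarrow> a $ j = 1")
    case True
    then show ?thesis by (simp add: ideal_response_def factor)
  next
    case False
    then have "(\<Prod>j\<in>UNIV. of_bool (i \<in> requiring Q j \<longrightarrow> a $ j = 1)) = (0::nat)"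
      by (intro prod_zero) auto
    with False show ?thesis by (simp add: ideal_response_def factor)
  qed
qed

lemma mem_mastered_iff:
  assumes "Q_matrix Q" "a \<in> binary_vectors"
  shows "i \<in> mastered Q a \<longleftrightarrow> (\<forall>j. i \<in> requiring Q j \<longrightarrow> a $ j = 1)"
  using ideal_response_eq[OF assms, of i] by (simp add: mastered_def)

lemma ideal_response_eq_mastered:
  assumes "Q_matrix Q" "a \<in> binary_vectors"
  shows "ideal_response Q a $ i = of_bool (i \<in> mastered Q a)"
  by (simp add: ideal_response_eq[OF assms] mem_mastered_iff[OF assms])

lemma compl_mastered:
  assumes "Q_matrix Q" "a \<in> binary_vectors"
  shows "- mastered Q a = (\<Union>j\<in>{j. a $ j = 0}. requiring Q j)"
proof -
  have "a $ j \<noteq> 1 \<longleftrightarrow> a $ j = 0" for j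
    using assms(2) by (auto simp: binary_vectors_def)
  then show ?thesis
    using mem_mastered_iff[OF assms] by blast
qed

lemma mastered_zero:
  assumes "Q_matrix Q"
  shows "mastered Q 0 = {}"
proof -
  have "\<exists>j. i \<in> requiring Q j" for i
  proof -
    have "row i Q \<noteq> 0" using assms by (simp add: Q_matrix_def)
    then obtain j where "Q $ i $ j \<noteq> 0" by (auto simp: row_def vec_eq_iff)
    then show ?thesis using Q_matrix_entry[OF assms, of i j] by (auto simp: requiring_def)
  qed
  then show ?thesis
    using mem_mastered_iff[OF assms, of 0] by (auto simp: binary_vectors_def)
qed

lemma requiring_eq_compl_mastered:
  assumes "Q_matrix Q"
  shows "\<exists>a\<in>binary_vectors. requiring Q j = - mastered Q a"
proof
  let ?a = "\<chi> l. if l = j then 0 else (1 :: nat)"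
  show a: "?a \<in> binary_vectors" by (simp add: binary_vectors_def)
  show "requiring Q j = - mastered Q ?a"
    using compl_mastered[OF assms a] by auto
qed

section \<open>Complete matrices\<close>

lemma complete_Q_item:
  assumes "complete_Q Q"
  shows "\<exists>i. \<forall>l. i \<in> requiring Q l \<longleftrightarrow> l = j"
proof -
  have "axis j 1 \<in> rows Q" using assms by (simp add: complete_Q_def)
  then obtain i where "row i Q = axis j 1" by (auto simp: rows_def)
  then have "Q $ i $ l = (if l = j then 1 else 0)" for l
    by (auto simp: row_def vec_eq_iff axis_def)
  then have "\<forall>l. i \<in> requiring Q l \<longleftrightarrow> l = j" by (simp add: requiring_def)
  then show ?thesis by blast
qed

lemma inj_on_mastered:
  fixes Q :: "nat ^ 'k ^ 'm"
  assumes Q: "Q_matrix Q" and "complete_Q Q"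
  shows "inj_on (mastered Q) binary_vectors"
proof (rule inj_onI)
  fix a b :: "nat ^ 'k"
  assume ab: "a \<in> binary_vectors" "b \<in> binary_vectors" and eq: "mastered Q a = mastered Q b"
  have "a $ j = b $ j" for j
  proof -
    obtain i where i: "\<And>l. i \<in> requiring Q l \<longleftrightarrow> l = j"
      using complete_Q_item[OF assms(2)] by blast
    have "a $ j = 1 \<longleftrightarrow> b $ j = 1"
      using eq mem_mastered_iff[OF Q ab(1), of i] mem_mastered_iff[OF Q ab(2), of i] i by auto
    moreover have "a $ j \<in> {0, 1}" "b $ j \<in> {0, 1}"
      using ab unfolding binary_vectors_def by blast+
    ultimately show ?thesis by auto
  qed
  then show "a = b" by (simp add: vec_eq_iff)
qed

text \<open>
  The second matrix is not assumed to be complete. If two families of sets have the same unions and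
  each member of the first contains a point that lies in no other member of the first, then the
  first family is contained in the second. For the columns equality follows by counting, as both
  matrices have \<open>k\<close> columns and those of \<open>Q\<close> are distinct.
\<close>

lemma col_equiv_if_mastered_subset:
  fixes Q Q' :: "nat ^ 'k ^ 'm"
  assumes Q: "Q_matrix Q" and complete: "complete_Q Q" and Q': "Q_matrix Q'"
    and sub: "mastered Q ` binary_vectors \<subseteq> mastered Q' ` binary_vectors"
  shows "Q' \<sim>\<^sub>Q Q"
proof -
  have "card (mastered Q' ` binary_vectors) \<le> card (binary_vectors :: (nat ^ 'k) set)"
    by (rule card_image_le[OF finite_binary_vectors])
  also have "\<dots> = card (mastered Q ` binary_vectors)"
    by (simp add: card_image inj_on_mastered[OF Q complete])
  finally have range_eq: "mastered Q ` binary_vectors = mastered Q' ` binary_vectors"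
    by (intro card_seteq sub) (simp_all add: finite_binary_vectors)

  have "\<exists>l. requiring Q' l = requiring Q j" for j
  proof -
    obtain i where i: "\<And>l. i \<in> requiring Q l \<longleftrightarrow> l = j"
      using complete_Q_item[OF complete] by blast
    obtain a where a: "a \<in> binary_vectors" "requiring Q j = - mastered Q a"
      using requiring_eq_compl_mastered[OF Q] by blast
    have "mastered Q a \<in> mastered Q' ` binary_vectors"
      using imageI[OF a(1), of "mastered Q"] range_eq by simp
    then obtain a' where a': "a' \<in> binary_vectors" "requiring Q j = - mastered Q' a'"
      using a(2) by auto
    have union: "requiring Q j = (\<Union>l\<in>{l. a' $ l = 0}. requiring Q' l)"
      using a' compl_mastered[OF Q'] by simp
    then obtain l where l: "i \<in> requiring Q' l" "requiring Q' l \<subseteq> requiring Q j"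
      using i[of j] by blast
    obtain b' where b': "b' \<in> binary_vectors" "requiring Q' l = - mastered Q' b'"
      using requiring_eq_compl_mastered[OF Q'] by blast
    have "mastered Q' b' \<in> mastered Q ` binary_vectors"
      using imageI[OF b'(1), of "mastered Q'"] range_eq by simp
    then obtain b where b: "b \<in> binary_vectors" "requiring Q' l = - mastered Q b"
      using b'(2) by auto
    have "requiring Q' l = (\<Union>h\<in>{h. b $ h = 0}. requiring Q h)"
      using b compl_mastered[OF Q] by simp
    with l(1) i have "requiring Q j \<subseteq> requiring Q' l" by auto
    with l(2) show ?thesis by blast
  qed
  then obtain \<sigma> where \<sigma>: "\<And>j. requiring Q' (\<sigma> j) = requiring Q j"
    by metis
  have "inj \<sigma>"
  proof (rule injI)
    fix j j' assume "\<sigma> j = \<sigma> j'"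
    then have eq: "requiring Q j = requiring Q j'" using \<sigma> by metis
    obtain i where "\<forall>l. i \<in> requiring Q l \<longleftrightarrow> l = j"
      using complete_Q_item[OF complete] by blast
    with eq show "j = j'" by metis
  qed
  then have "bij \<sigma>" by (simp add: bij_def finite_UNIV_inj_surj)
  have "column j Q' = column (inv \<sigma> j) Q" for j
  proof -
    have "requiring Q' j = requiring Q (inv \<sigma> j)"
      using \<sigma>[of "inv \<sigma> j"] \<open>bij \<sigma>\<close> by (simp add: bij_is_surj surj_f_inv_f)
    then have "Q' $ i $ j = 1 \<longleftrightarrow> Q $ i $ inv \<sigma> j = 1" for i
      unfolding requiring_def by blast
    then have "Q' $ i $ j = Q $ i $ inv \<sigma> j" for i
      using Q_matrix_entry[OF Q, of i "inv \<sigma> j"] Q_matrix_entry[OF Q', of i j] by metis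
    then show ?thesis by (simp add: column_def vec_eq_iff)
  qed
  then show ?thesis
    unfolding col_equiv_def using bij_imp_bij_inv[OF \<open>bij \<sigma>\<close>] by blast
qed

section \<open>Inversion of the saturated T-matrix\<close>

text \<open>
  Expansion of the product of all \<open>x i\<close> with \<open>i \<in> s\<close> and all \<open>1 - x i\<close> with \<open>i \<notin> s\<close>, where \<open>x i\<close> is
  the ideal response to item \<open>i\<close>.
\<close>

lemma sum_T_entry_alternating:
  fixes Q :: "nat ^ 'k ^ 'm"
  assumes "Q_matrix Q" "a \<in> binary_vectors"
  shows "(\<Sum>X\<in>Pow (- s). (-1) ^ card X * T_entry Q (s \<union> X) a) = of_bool (mastered Q a = s)"
proof -
  define x where "x i = real (ideal_response Q a $ i)" for i
  have x: "x i = of_bool (i \<in> mastered Q a)" for i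
    by (simp add: x_def ideal_response_eq_mastered[OF assms])
  have "(\<Sum>X\<in>Pow (- s). (-1) ^ card X * T_entry Q (s \<union> X) a)
      = (\<Sum>X\<in>Pow (- s). prod x s * ((-1) ^ card X * prod x X * (\<Prod>i\<in>- s - X. 1)))"
  proof (rule sum.cong)
    fix X assume "X \<in> Pow (- s)"
    then have "prod x (s \<union> X) = prod x s * prod x X"
      by (intro prod.union_disjoint) auto
    then show "(-1) ^ card X * T_entry Q (s \<union> X) a
        = prod x s * ((-1) ^ card X * prod x X * (\<Prod>i\<in>- s - X. 1))"
      by (simp add: T_entry_def x_def)
  qed simp
  also have "\<dots> = prod x s * (\<Prod>i\<in>- s. 1 - x i)"
    by (subst prod_diff_conv_sum) (simp_all add: sum_distrib_left)
  also have "\<dots> = of_bool (mastered Q a = s)"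
  proof (cases "mastered Q a = s")
    case True
    then show ?thesis by (simp add: x)
  next
    case False
    then obtain i where "i \<in> s \<and> i \<notin> mastered Q a \<or> i \<in> - s \<and> i \<in> mastered Q a"
      by blast
    then show ?thesis
    proof
      assume "i \<in> s \<and> i \<notin> mastered Q a"
      then have "prod x s = 0" by (intro prod_zero) (auto simp: x)
      with False show ?thesis by simp
    next
      assume "i \<in> - s \<and> i \<in> mastered Q a"
      then have "(\<Prod>i\<in>- s. 1 - x i) = 0" by (intro prod_zero) (auto simp: x)
      with False show ?thesis by simp
    qed
  qed
  finally show ?thesis .
qed

text \<open>The weight that \<open>p\<close> puts on the attribute vectors whose set of mastered items is \<open>s\<close>.\<close>

definition mastered_weight ::
  "nat ^ 'k ^ 'm \<Rightarrow> (nat ^ 'k \<Rightarrow> real) \<Rightarrow> 'm set \<Rightarrow> real" where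
  "mastered_weight Q p s = (\<Sum>a | a \<in> nonzero_attributes \<and> mastered Q a = s. p a)"

lemma mastered_weight_eq_sum_T_mult:
  fixes Q :: "nat ^ 'k ^ 'm"
  assumes "Q_matrix Q"
  shows "mastered_weight Q p s = (\<Sum>X\<in>Pow (- s). (-1) ^ card X * T_mult Q p (s \<union> X))"
proof -
  have "(\<Sum>X\<in>Pow (- s). (-1) ^ card X * T_mult Q p (s \<union> X))
      = (\<Sum>a\<in>nonzero_attributes. \<Sum>X\<in>Pow (- s). (-1) ^ card X * T_entry Q (s \<union> X) a * p a)"
    unfolding T_mult_def sum_distrib_left by (subst sum.swap) (simp add: mult.assoc)
  also have "\<dots> = (\<Sum>a\<in>nonzero_attributes. of_bool (mastered Q a = s) * p a)"
  proof (rule sum.cong)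
    fix a :: "nat ^ 'k" assume "a \<in> nonzero_attributes"
    then have "a \<in> binary_vectors" by (simp add: nonzero_attributes_def)
    then show "(\<Sum>X\<in>Pow (- s). (-1) ^ card X * T_entry Q (s \<union> X) a * p a)
        = of_bool (mastered Q a = s) * p a"
      by (simp add: sum_T_entry_alternating[OF assms] flip: sum_distrib_right)
  qed simp
  also have "\<dots> = (\<Sum>a\<in>nonzero_attributes. if mastered Q a = s then p a else 0)"
    by (intro sum.cong) auto
  also have "\<dots> = mastered_weight Q p s"
    unfolding mastered_weight_def
    by (subst sum.inter_filter[symmetric]) (simp_all add: finite_nonzero_attributes)
  finally show ?thesis by simp
qed

text \<open>
  Each of the at most \<open>2\<^sup>m\<close> terms in the inversion formula is off by at most the residual. The
  inversion for \<open>s\<close> uses the rows \<open>s \<union> X\<close>, which exist in a saturated \<open>T\<close>-matrix because \<open>s\<close> is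
  nonempty.
\<close>

lemma mastered_weight_diff_le:
  fixes Q Q' :: "nat ^ 'k ^ 'm"
  assumes Q: "Q_matrix Q" and Q': "Q_matrix Q'" and C: "saturated C" and s: "s \<noteq> {}"
  shows "\<bar>mastered_weight Q' p' s - mastered_weight Q p s\<bar>
    \<le> real CARD('m set) * residual C (T_mult Q p) Q' p'"
proof -
  let ?d = "\<lambda>I. T_mult Q' p' I - T_mult Q p I"
  let ?res = "residual C (T_mult Q p) Q' p'"
  have "\<bar>mastered_weight Q' p' s - mastered_weight Q p s\<bar>
      = \<bar>\<Sum>X\<in>Pow (- s). (-1) ^ card X * ?d (s \<union> X)\<bar>"
    by (simp add: mastered_weight_eq_sum_T_mult[OF Q] mastered_weight_eq_sum_T_mult[OF Q']
        right_diff_distrib sum_subtractf)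
  also have "\<dots> \<le> (\<Sum>X\<in>Pow (- s). \<bar>?d (s \<union> X)\<bar>)"
    by (rule order.trans[OF sum_abs]) (simp add: abs_mult power_abs)
  also have "\<dots> \<le> (\<Sum>X\<in>Pow (- s). ?res)"
  proof (rule sum_mono)
    fix X
    have "s \<union> X \<in> C" using C s by (simp add: saturated_def)
    then have "\<bar>?d (s \<union> X)\<bar> \<le> L2_set (\<lambda>I. \<bar>?d I\<bar>) C"
      by (intro member_le_L2_set[of C "s \<union> X" "\<lambda>I. \<bar>?d I\<bar>"]) simp_all
    then show "\<bar>?d (s \<union> X)\<bar> \<le> ?res"
      by (simp add: residual_def L2_set_def)
  qed
  also have "\<dots> = real (card (Pow (- s))) * ?res" by simp
  also have "\<dots> \<le> real CARD('m set) * ?res"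
    by (intro mult_right_mono of_nat_mono card_mono) (simp_all add: residual_def)
  finally show ?thesis .
qed

section \<open>Empirical frequencies and minimizers\<close>

text \<open>The relative frequency of the value \<open>a\<close> among \<open>A 1, \<dots>, A N\<close>.\<close>

definition empirical_freq :: "nat \<Rightarrow> (nat \<Rightarrow> 'a) \<Rightarrow> 'a \<Rightarrow> real" where
  "empirical_freq N A a = real (card {r \<in> {1..N}. A r = a}) / real N"

lemma empirical_freq_eq_sum: "empirical_freq N A a = (\<Sum>r\<in>{1..N}. of_bool (A r = a)) / real N"
  unfolding empirical_freq_def by (simp add: sum.inter_filter Int_def)

lemma empirical_freq_sub_probabilities:
  fixes A :: "nat \<Rightarrow> nat ^ 'k"
  assumes "N \<ge> 1"
  shows "empirical_freq N A \<in> sub_probabilities"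
proof -
  have nonneg: "empirical_freq N A a \<ge> 0" for a by (simp add: empirical_freq_def)
  have total: "(\<Sum>a\<in>nonzero_attributes. empirical_freq N A a) \<le> 1"
  proof -
    have "(\<Sum>a\<in>nonzero_attributes. empirical_freq N A a)
        = (\<Sum>r\<in>{1..N}. \<Sum>a\<in>nonzero_attributes. of_bool (A r = a)) / real N"
      unfolding empirical_freq_eq_sum sum_divide_distrib[symmetric] by (subst sum.swap) simp
    also have "\<dots> \<le> (\<Sum>r\<in>{1..N}. 1) / real N"
    proof (intro divide_right_mono sum_mono)
      fix r
      have "(\<Sum>a\<in>nonzero_attributes. of_bool (A r = a) :: real)
          = (if A r \<in> nonzero_attributes then 1 else 0)"
        by (simp add: of_bool_def finite_nonzero_attributes)
      then show "(\<Sum>a\<in>nonzero_attributes. of_bool (A r = a) :: real) \<le> 1" by simp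
    qed simp
    also have "\<dots> = 1" using assms by simp
    finally show ?thesis .
  qed
  have "empirical_freq N A a \<le> 1" if "a \<in> nonzero_attributes" for a
  proof -
    have "empirical_freq N A a \<le> (\<Sum>a\<in>nonzero_attributes. empirical_freq N A a)"
      by (rule member_le_sum[OF that nonneg finite_nonzero_attributes])
    with total show ?thesis by linarith
  qed
  with nonneg total show ?thesis
    by (auto simp: sub_probabilities_def intro!: sum_nonneg)
qed

lemma T_mult_empirical_freq:
  fixes Q :: "nat ^ 'k ^ 'm"
  assumes Q: "Q_matrix Q" and A: "\<forall>r\<in>{1..N}. A r \<in> binary_vectors"
    and R: "\<forall>r\<in>{1..N}. R r = ideal_response Q (A r)" and I: "I \<noteq> {}"
  shows "T_mult Q (empirical_freq N A) I = alpha N R I"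
proof -
  have T: "T_entry Q I a = of_bool (I \<subseteq> mastered Q a)" if "a \<in> binary_vectors" for a
  proof (cases "I \<subseteq> mastered Q a")
    case True
    then have "(\<Prod>i\<in>I. ideal_response Q a $ i) = 1"
      by (intro prod.neutral) (auto simp: ideal_response_eq_mastered[OF Q that])
    with True show ?thesis by (simp add: T_entry_def)
  next
    case False
    then have "(\<Prod>i\<in>I. ideal_response Q a $ i) = 0"
      by (intro prod_zero) (auto simp: ideal_response_eq_mastered[OF Q that])
    with False show ?thesis by (simp add: T_entry_def)
  qed
  have "T_mult Q (empirical_freq N A) I
      = (\<Sum>r\<in>{1..N}. \<Sum>a\<in>nonzero_attributes. T_entry Q I a * of_bool (A r = a)) / real N"
    unfolding T_mult_def empirical_freq_eq_sum times_divide_eq_right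
      sum_divide_distrib[symmetric] sum_distrib_left
    by (subst sum.swap) simp
  also have "(\<Sum>r\<in>{1..N}. \<Sum>a\<in>nonzero_attributes. T_entry Q I a * of_bool (A r = a))
      = (\<Sum>r\<in>{1..N}. of_bool (\<forall>i\<in>I. R r $ i = 1))"
  proof (rule sum.cong)
    fix r assume r: "r \<in> {1..N}"
    have Ar: "A r \<in> binary_vectors" and Rr: "R r = ideal_response Q (A r)"
      using A R r by blast+
    have "(\<Sum>a\<in>nonzero_attributes. T_entry Q I a * of_bool (A r = a))
        = (\<Sum>a\<in>nonzero_attributes. if A r = a then T_entry Q I a else 0)"
      by (intro sum.cong) auto
    also have "\<dots> = (if A r \<in> nonzero_attributes then T_entry Q I (A r) else 0)"
      by (simp add: finite_nonzero_attributes)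
    \<comment> \<open>A subject without any attribute masters no item, so omitting the column of the zero vector
      loses nothing.\<close>
    also have "\<dots> = T_entry Q I (A r)"
      using Ar T[OF Ar] mastered_zero[OF Q] I by (auto simp: nonzero_attributes_def)
    also have "\<dots> = of_bool (\<forall>i\<in>I. R r $ i = 1)"
      using T[OF Ar] Rr by (auto simp: mastered_def)
    finally show "(\<Sum>a\<in>nonzero_attributes. T_entry Q I a * of_bool (A r = a))
        = of_bool (\<forall>i\<in>I. R r $ i = 1)" .
  qed simp
  also have "(\<Sum>r\<in>{1..N}. of_bool (\<forall>i\<in>I. R r $ i = 1)) / real N = alpha N R I"
    by (simp add: alpha_def Int_def)
  finally show ?thesis .
qed

lemma residual_eq_empirical_freq:
  fixes Q :: "nat ^ 'k ^ 'm"
  assumes Q: "Q_matrix Q" and C: "saturated C"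
    and A: "\<forall>r\<in>{1..N}. A r \<in> binary_vectors"
    and R: "\<forall>r\<in>{1..N}. R r = ideal_response Q (A r)"
  shows "residual C (alpha N R) Q' p = residual C (T_mult Q (empirical_freq N A)) Q' p"
  unfolding residual_def
  by (rule L2_set_cong)
    (use C in \<open>simp_all add: saturated_def T_mult_empirical_freq[OF Q A R]\<close>)

text \<open>
  A candidate that cannot produce the set of items mastered by some \<open>a\<close> has weight 0 on that set for
  every \<open>p\<close>, so \<open>mastered_weight_diff_le\<close> bounds all its residuals below by a positive multiple of
  the frequency of \<open>a\<close>. As this bound is uniform in \<open>p\<close>, it does not matter whether the infimum
  defining \<open>S\<close> is attained.
\<close>

lemma minimizer_col_equiv:
  fixes Q Qh :: "nat ^ 'k ^ 'm"
  assumes Q: "Q_matrix Q" and complete: "complete_Q Q" and C: "saturated C" and N: "N \<ge> 1"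
    and A: "\<forall>r\<in>{1..N}. A r \<in> binary_vectors"
    and R: "\<forall>r\<in>{1..N}. R r = ideal_response Q (A r)"
    and pos: "\<And>a. a \<in> nonzero_attributes \<Longrightarrow> empirical_freq N A a > 0"
    and min: "is_arg_min (S C (alpha N R)) Q_matrix Qh"
  shows "Qh \<sim>\<^sub>Q Q"
proof -
  let ?f = "empirical_freq N A" and ?c = "real CARD('m set)"
  note res = residual_eq_empirical_freq[OF Q C A R]
  have Qh: "Q_matrix Qh" using min by (simp add: is_arg_min_def)
  have bdd: "bdd_below ((\<lambda>p. residual C (alpha N R) Q p) ` sub_probabilities)"
    by (rule bdd_belowI[of _ 0]) (auto simp: residual_def)
  have "S C (alpha N R) Q \<le> residual C (alpha N R) Q ?f"
    unfolding S_def by (rule cINF_lower[OF bdd empirical_freq_sub_probabilities[OF N]])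
  also have "\<dots> = 0"
    by (subst res) (simp_all add: residual_def L2_set_def)
  finally have "S C (alpha N R) Q \<le> 0" .
  moreover have "\<not> S C (alpha N R) Q < S C (alpha N R) Qh"
    using min Q by (auto simp: is_arg_min_def)
  ultimately have S_le: "S C (alpha N R) Qh \<le> 0" by linarith

  \<comment> \<open>The empty set needs no attention: the zero vector produces it under every \<open>Q\<close>-matrix.\<close>
  have "mastered Q a \<in> mastered Qh ` binary_vectors" if a: "a \<in> binary_vectors" for a
  proof (rule ccontr)
    assume not: "mastered Q a \<notin> mastered Qh ` binary_vectors"
    have "(0 :: nat ^ 'k) \<in> binary_vectors" by (simp add: binary_vectors_def)
    with not have ne: "mastered Q a \<noteq> {}"
      using mastered_zero[OF Qh] by (metis imageI)
    then have a_nz: "a \<in> nonzero_attributes"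
      using a mastered_zero[OF Q] by (auto simp: nonzero_attributes_def)
    have "{b. b \<in> nonzero_attributes \<and> mastered Q b = mastered Q a} = {a}"
      using a a_nz inj_onD[OF inj_on_mastered[OF Q complete]]
      by (auto simp: nonzero_attributes_def)
    then have wQ: "mastered_weight Q ?f (mastered Q a) = ?f a"
      by (simp add: mastered_weight_def)
    have wQh: "mastered_weight Qh p (mastered Q a) = 0" for p
    proof -
      have none: "{b. b \<in> nonzero_attributes \<and> mastered Qh b = mastered Q a} = {}"
        using not by (auto simp: nonzero_attributes_def image_iff)
      show ?thesis unfolding mastered_weight_def none by simp
    qed
    have "?f a / ?c \<le> S C (alpha N R) Qh"
      unfolding S_def
    proof (rule cINF_greatest)
      show "(sub_probabilities :: (nat ^ 'k \<Rightarrow> real) set) \<noteq> {}"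
        using empirical_freq_sub_probabilities[OF N] by blast
      fix p :: "nat ^ 'k \<Rightarrow> real"
      have "?f a \<le> ?c * residual C (T_mult Q ?f) Qh p"
        using mastered_weight_diff_le[OF Q Qh C ne, of p ?f] by (simp add: wQ wQh)
      also have "residual C (T_mult Q ?f) Qh p = residual C (alpha N R) Qh p"
        by (rule res[symmetric])
      finally show "?f a / ?c \<le> residual C (alpha N R) Qh p"
        by (simp add: divide_le_eq mult.commute card_gt_0_iff)
    qed
    moreover have "?f a / ?c > 0" using pos[OF a_nz] by (simp add: card_gt_0_iff)
    ultimately show False using S_le by linarith
  qed
  then show ?thesis
    by (intro col_equiv_if_mastered_subset[OF Q complete Qh]) blast
qed

lemma minimizer_eq_empirical_freq:
  fixes Q :: "nat ^ 'k ^ 'm"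
  assumes Q: "Q_matrix Q" and complete: "complete_Q Q" and C: "saturated C" and N: "N \<ge> 1"
    and A: "\<forall>r\<in>{1..N}. A r \<in> binary_vectors"
    and R: "\<forall>r\<in>{1..N}. R r = ideal_response Q (A r)"
    and min: "is_arg_min (\<lambda>p. (residual C (alpha N R) Q p)\<^sup>2) (\<lambda>p. p \<in> sub_probabilities) p"
    and a: "a \<in> nonzero_attributes"
  shows "p a = empirical_freq N A a"
proof -
  let ?f = "empirical_freq N A"
  note res = residual_eq_empirical_freq[OF Q C A R]
  have "residual C (alpha N R) Q ?f = 0"
    by (subst res) (simp_all add: residual_def L2_set_def)
  moreover have "\<not> (residual C (alpha N R) Q ?f)\<^sup>2 < (residual C (alpha N R) Q p)\<^sup>2"
    using min empirical_freq_sub_probabilities[OF N] by (auto simp: is_arg_min_def)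
  ultimately have "residual C (alpha N R) Q p = 0" by simp
  then have res0: "residual C (T_mult Q ?f) Q p = 0"
    by (subst (asm) res)
  have a_bin: "a \<in> binary_vectors" and "a \<noteq> 0"
    using a by (auto simp: nonzero_attributes_def)
  have zero: "(0 :: nat ^ 'k) \<in> binary_vectors" by (simp add: binary_vectors_def)
  have ne: "mastered Q a \<noteq> {}"
    using inj_onD[OF inj_on_mastered[OF Q complete] _ a_bin zero] \<open>a \<noteq> 0\<close> mastered_zero[OF Q]
    by metis
  have "{b. b \<in> nonzero_attributes \<and> mastered Q b = mastered Q a} = {a}"
    using a inj_onD[OF inj_on_mastered[OF Q complete]] by (auto simp: nonzero_attributes_def)
  then have "mastered_weight Q q (mastered Q a) = q a" for q
    by (simp add: mastered_weight_def)
  then show ?thesis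
    using mastered_weight_diff_le[OF Q Q C ne, of p ?f] res0 by simp
qed

section \<open>Convergence of the empirical frequencies\<close>

lemma (in prob_space) empirical_freq_Hoeffding:
  fixes A :: "nat \<Rightarrow> 'a \<Rightarrow> 'b"
  assumes indep: "indep_vars (\<lambda>_. count_space B) A {1..}"
    and distr: "\<And>r. r \<ge> 1 \<Longrightarrow> prob {\<omega> \<in> space M. A r \<omega> = a} = p"
    and N: "N \<ge> 1" and \<delta>: "\<delta> > 0"
  shows "prob {\<omega> \<in> space M. \<bar>empirical_freq N (\<lambda>r. A r \<omega>) a - p\<bar> \<ge> \<delta>}
    \<le> 2 * exp (- 2 * real N * \<delta>\<^sup>2)"
proof -
  define X where "X r \<omega> = (of_bool (A r \<omega> = a) :: real)" for r \<omega>
  have "indep_vars (\<lambda>_. count_space B) A {1..N}"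
    by (rule indep_vars_subset[OF indep]) auto
  then have indep_X: "indep_vars (\<lambda>_. borel) X {1..N}"
    unfolding X_def by (rule indep_vars_compose2) simp
  have exp_X: "expectation (X r) = p" if "r \<in> {1..N}" for r
  proof -
    have "X r = indicator {\<omega>. A r \<omega> = a}" by (auto simp: X_def indicator_def)
    then have "expectation (X r) = prob ({\<omega>. A r \<omega> = a} \<inter> space M)" by simp
    also have "{\<omega>. A r \<omega> = a} \<inter> space M = {\<omega> \<in> space M. A r \<omega> = a}" by auto
    finally show ?thesis using distr that by simp
  qed
  interpret H: Hoeffding_ineq M "{1..N}" X "\<lambda>_. 0" "\<lambda>_. 1" "\<Sum>r\<in>{1..N}. expectation (X r)"
    by unfold_locales (use indep_X in \<open>auto simp: X_def\<close>)
  have "\<bar>empirical_freq N (\<lambda>r. A r \<omega>) a - p\<bar> \<ge> \<delta> \<longleftrightarrow>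
      \<bar>(\<Sum>r\<in>{1..N}. X r \<omega>) - (\<Sum>r\<in>{1..N}. expectation (X r))\<bar> \<ge> real N * \<delta>" for \<omega>
  proof -
    have "empirical_freq N (\<lambda>r. A r \<omega>) a - p
        = ((\<Sum>r\<in>{1..N}. X r \<omega>) - (\<Sum>r\<in>{1..N}. expectation (X r))) / real N"
      using N by (simp add: empirical_freq_eq_sum X_def[symmetric] exp_X diff_divide_distrib
          del: sum_of_bool_eq)
    then show ?thesis using N by (simp add: le_divide_eq mult.commute)
  qed
  then have "prob {\<omega> \<in> space M. \<bar>empirical_freq N (\<lambda>r. A r \<omega>) a - p\<bar> \<ge> \<delta>}
      \<le> 2 * exp (- 2 * (real N * \<delta>)\<^sup>2 / (\<Sum>r\<in>{1..N}. (1 - 0)\<^sup>2))"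
    using H.Hoeffding_ineq_abs_ge[of "real N * \<delta>"] N \<delta> by simp
  also have "\<dots> = 2 * exp (- 2 * real N * \<delta>\<^sup>2)"
    using N by (simp add: power2_eq_square)
  finally show ?thesis .
qed

lemma (in prob_space) measurable_empirical_freq:
  fixes A :: "nat \<Rightarrow> 'a \<Rightarrow> 'b"
  assumes "indep_vars (\<lambda>_. count_space B) A {1..}"
  shows "(\<lambda>\<omega>. empirical_freq N (\<lambda>r. A r \<omega>) a) \<in> borel_measurable M"
proof -
  have [measurable]: "(\<lambda>\<omega>. of_bool (A r \<omega> = a) :: real) \<in> borel_measurable M" if "r \<in> {1..N}" for r
  proof -
    have "A r \<in> measurable M (count_space B)"
      using assms that by (auto simp: indep_vars_def)
    then show ?thesis
      by (rule measurable_compose[where g = "\<lambda>x. of_bool (x = a)"]) simp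
  qed
  show ?thesis
    unfolding empirical_freq_eq_sum by (intro borel_measurable_divide borel_measurable_sum) simp_all
qed

lemma (in prob_space) empirical_freq_uniform_tendsto:
  fixes A :: "nat \<Rightarrow> 'a \<Rightarrow> 'b"
  assumes indep: "indep_vars (\<lambda>_. count_space B) A {1..}" and fin: "finite B"
    and distr: "\<And>r a. r \<ge> 1 \<Longrightarrow> a \<in> B \<Longrightarrow> prob {\<omega> \<in> space M. A r \<omega> = a} = p a"
    and \<delta>: "\<delta> > 0"
  shows "(\<lambda>N. prob {\<omega> \<in> space M. \<forall>a\<in>B. \<bar>empirical_freq N (\<lambda>r. A r \<omega>) a - p a\<bar> < \<delta>})
    \<longlonglongrightarrow> 1"
proof (rule tendsto_sandwich[where h = "\<lambda>_. 1"])
  let ?good = "\<lambda>N. {\<omega> \<in> space M. \<forall>a\<in>B. \<bar>empirical_freq N (\<lambda>r. A r \<omega>) a - p a\<bar> < \<delta>}"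
  let ?bad = "\<lambda>N a. {\<omega> \<in> space M. \<bar>empirical_freq N (\<lambda>r. A r \<omega>) a - p a\<bar> \<ge> \<delta>}"
  note [measurable] = measurable_empirical_freq[OF indep]
  have "1 - real (card B) * (2 * exp (- 2 * real N * \<delta>\<^sup>2)) \<le> prob (?good N)" if "N \<ge> 1" for N
  proof -
    have "1 - prob (?good N) = prob (space M - ?good N)"
      by (rule prob_compl[symmetric]) (use fin in measurable)
    also have "space M - ?good N = (\<Union>a\<in>B. ?bad N a)" by auto
    also have "prob \<dots> \<le> (\<Sum>a\<in>B. prob (?bad N a))"
      by (rule finite_measure_subadditive_finite[OF fin]) auto
    also have "\<dots> \<le> (\<Sum>a\<in>B. 2 * exp (- 2 * real N * \<delta>\<^sup>2))"
      by (intro sum_mono empirical_freq_Hoeffding[OF indep distr that \<delta>])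
    finally show ?thesis by simp
  qed
  then show "\<forall>\<^sub>F N in sequentially.
      1 - real (card B) * (2 * exp (- 2 * real N * \<delta>\<^sup>2)) \<le> prob (?good N)"
    by (auto simp: eventually_sequentially)
  show "(\<lambda>N. 1 - real (card B) * (2 * exp (- 2 * real N * \<delta>\<^sup>2))) \<longlonglongrightarrow> 1"
    using \<delta> by real_asymp
qed simp_all

lemma (in prob_space) prob_tendsto_1_superset:
  assumes "(\<lambda>N. prob (G N)) \<longlonglongrightarrow> 1"
    and "\<And>N. N \<ge> 1 \<Longrightarrow> G N \<subseteq> E N" "\<And>N. N \<ge> 1 \<Longrightarrow> E N \<in> events"
  shows "(\<lambda>N. prob (E N)) \<longlonglongrightarrow> 1"
proof (rule tendsto_sandwich[OF _ _ assms(1), where h = "\<lambda>_. 1"])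
  show "\<forall>\<^sub>F N in sequentially. prob (G N) \<le> prob (E N)"
    using eventually_ge_at_top[of 1] by eventually_elim (intro finite_measure_mono assms(2,3))
qed simp_all

section \<open>Consistency of the estimators\<close>

theorem theorem2p4:
  fixes M :: "'w measure"
    and Q :: "nat ^ 'k ^ 'm"
    and C :: "'m set set"
    and A :: "nat \<Rightarrow> 'w \<Rightarrow> nat ^ 'k"
    and R :: "nat \<Rightarrow> 'w \<Rightarrow> nat ^ 'm"
    and pstar :: "nat ^ 'k \<Rightarrow> real"
    and Qhat :: "nat \<Rightarrow> 'w \<Rightarrow> nat ^ 'k ^ 'm"
  assumes prob_space: "prob_space M"
    and Q: "Q_matrix Q"
    and C1: "complete_Q Q"
    and C2: "saturated C"
    and C3_indep: "prob_space.indep_vars M (\<lambda>_. count_space binary_vectors) A {1..}"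
    and C3_distr: "\<forall>r\<ge>1. \<forall>a\<in>binary_vectors. measure M {\<omega> \<in> space M. A r \<omega> = a} = pstar a"
    and C4: "\<forall>a\<in>binary_vectors. pstar a > 0"
    and C5: "\<forall>j. card {i. Q $ i $ j = 1} \<ge> 2"
    and response: "\<forall>r\<ge>1. \<forall>\<omega>\<in>space M. R r \<omega> = ideal_response Q (A r \<omega>)"
    and Qhat_measurable: "\<forall>N\<ge>1. Qhat N \<in> measurable M (count_space {Q'. Q_matrix Q'})"
    and Qhat_minimizer: "\<forall>N\<ge>1. \<forall>\<omega>\<in>space M.
          is_arg_min (S C (alpha N (\<lambda>r. R r \<omega>))) Q_matrix (Qhat N \<omega>)"
  shows "((\<lambda>N. measure M {\<omega> \<in> space M. Qhat N \<omega> \<sim>\<^sub>Q Q}) \<longlonglongrightarrow> 1) \<and>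
    (\<forall>(Qarr :: nat \<Rightarrow> 'w \<Rightarrow> nat ^ 'k ^ 'm) (ptilde :: nat \<Rightarrow> 'w \<Rightarrow> nat ^ 'k \<Rightarrow> real).
       (\<forall>N\<ge>1. \<forall>\<omega>\<in>space M. Qarr N \<omega> \<sim>\<^sub>Q Qhat N \<omega> \<and> (Qhat N \<omega> \<sim>\<^sub>Q Q \<longrightarrow> Qarr N \<omega> = Q)) \<longrightarrow>
       (\<forall>N\<ge>1. \<forall>a\<in>nonzero_attributes. (\<lambda>\<omega>. ptilde N \<omega> a) \<in> borel_measurable M) \<longrightarrow>
       (\<forall>N\<ge>1. \<forall>\<omega>\<in>space M.
          is_arg_min (\<lambda>p. (residual C (alpha N (\<lambda>r. R r \<omega>)) (Qarr N \<omega>) p)\<^sup>2)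
            (\<lambda>p. p \<in> sub_probabilities) (ptilde N \<omega>)) \<longrightarrow>
       (\<forall>\<epsilon>>0. (\<lambda>N. measure M {\<omega> \<in> space M.
            L2_set (\<lambda>a. ptilde N \<omega> a - pstar a) nonzero_attributes \<le> \<epsilon>}) \<longlonglongrightarrow> 1))"
proof (intro conjI allI impI)
  interpret prob_space M by (rule prob_space)
  let ?f = "\<lambda>N \<omega>. empirical_freq N (\<lambda>r. A r \<omega>)"
  let ?G = "\<lambda>\<delta> N. {\<omega> \<in> space M. \<forall>a\<in>binary_vectors. \<bar>?f N \<omega> a - pstar a\<bar> < \<delta>}"
  have A: "A r \<omega> \<in> binary_vectors" if "\<omega> \<in> space M" "r \<in> {1..N}" for r \<omega> N
  proof -
    have "A r \<in> measurable M (count_space binary_vectors)"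
      using C3_indep that(2) by (auto simp: indep_vars_def)
    from measurable_space[OF this that(1)] show ?thesis by simp
  qed
  have R: "R r \<omega> = ideal_response Q (A r \<omega>)" if "\<omega> \<in> space M" "r \<in> {1..N}" for r \<omega> N
    using response that by simp
  have G: "(\<lambda>N. prob (?G \<delta> N)) \<longlonglongrightarrow> 1" if "\<delta> > 0" for \<delta>
    by (rule empirical_freq_uniform_tendsto[OF C3_indep finite_binary_vectors])
      (use C3_distr that in auto)

  define \<delta>0 where "\<delta>0 = Min (pstar ` binary_vectors)"
  have bin_ne: "(binary_vectors :: (nat ^ 'k) set) \<noteq> {}"
    by (auto simp: binary_vectors_def intro!: exI[of _ 0])
  have \<delta>0: "\<delta>0 > 0"
    unfolding \<delta>0_def using C4 bin_ne by (simp add: finite_binary_vectors)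
  have Qhat_equiv: "Qhat N \<omega> \<sim>\<^sub>Q Q" if N: "N \<ge> 1" and \<omega>: "\<omega> \<in> ?G \<delta> N" and le: "\<delta> \<le> \<delta>0" for N \<omega> \<delta>
  proof (rule minimizer_col_equiv[OF Q C1 C2 N])
    show "\<forall>r\<in>{1..N}. A r \<omega> \<in> binary_vectors" "\<forall>r\<in>{1..N}. R r \<omega> = ideal_response Q (A r \<omega>)"
      using A R \<omega> by blast+
    show "is_arg_min (S C (alpha N (\<lambda>r. R r \<omega>))) Q_matrix (Qhat N \<omega>)"
      using Qhat_minimizer N \<omega> by blast
    fix a :: "nat ^ 'k" assume "a \<in> nonzero_attributes"
    then have a: "a \<in> binary_vectors" by (simp add: nonzero_attributes_def)
    then have "\<delta>0 \<le> pstar a" unfolding \<delta>0_def by (simp add: finite_binary_vectors)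
    moreover have "\<bar>?f N \<omega> a - pstar a\<bar> < \<delta>" using \<omega> a by blast
    ultimately show "?f N \<omega> a > 0" using le by linarith
  qed

  show "(\<lambda>N. prob {\<omega> \<in> space M. Qhat N \<omega> \<sim>\<^sub>Q Q}) \<longlonglongrightarrow> 1"
  proof (rule prob_tendsto_1_superset[OF G[OF \<delta>0]])
    fix N :: nat assume N: "N \<ge> 1"
    show "?G \<delta>0 N \<subseteq> {\<omega> \<in> space M. Qhat N \<omega> \<sim>\<^sub>Q Q}"
      using Qhat_equiv[OF N] by blast
    have meas: "Qhat N \<in> measurable M (count_space {Q'. Q_matrix Q'})"
      using Qhat_measurable N by blast
    have "Qhat N -` {Q'. Q_matrix Q' \<and> Q' \<sim>\<^sub>Q Q} \<inter> space M \<in> events"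
      by (rule measurable_sets[OF meas]) auto
    also have "Qhat N -` {Q'. Q_matrix Q' \<and> Q' \<sim>\<^sub>Q Q} \<inter> space M
        = {\<omega> \<in> space M. Qhat N \<omega> \<sim>\<^sub>Q Q}"
      using measurable_space[OF meas] by auto
    finally show "{\<omega> \<in> space M. Qhat N \<omega> \<sim>\<^sub>Q Q} \<in> events" .
  qed

  fix Qarr :: "nat \<Rightarrow> 'w \<Rightarrow> nat ^ 'k ^ 'm" and ptilde :: "nat \<Rightarrow> 'w \<Rightarrow> nat ^ 'k \<Rightarrow> real"
    and \<epsilon> :: real
  assume Qarr: "\<forall>N\<ge>1. \<forall>\<omega>\<in>space M.
      Qarr N \<omega> \<sim>\<^sub>Q Qhat N \<omega> \<and> (Qhat N \<omega> \<sim>\<^sub>Q Q \<longrightarrow> Qarr N \<omega> = Q)"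
    and ptilde_meas: "\<forall>N\<ge>1. \<forall>a\<in>nonzero_attributes. (\<lambda>\<omega>. ptilde N \<omega> a) \<in> borel_measurable M"
    and ptilde_min: "\<forall>N\<ge>1. \<forall>\<omega>\<in>space M.
      is_arg_min (\<lambda>p. (residual C (alpha N (\<lambda>r. R r \<omega>)) (Qarr N \<omega>) p)\<^sup>2)
        (\<lambda>p. p \<in> sub_probabilities) (ptilde N \<omega>)"
    and \<epsilon>: "\<epsilon> > 0"
  let ?n = "real (card (nonzero_attributes :: (nat ^ 'k) set))"
  \<comment> \<open>The Euclidean distance is at most the sum of the \<open>?n\<close> coordinate distances; adding 1 to the
    number of coordinates makes the quotient meaningful without a proof that \<open>?n > 0\<close>.\<close>
  define \<delta> where "\<delta> = min \<delta>0 (\<epsilon> / (?n + 1))"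
  have \<delta>: "\<delta> > 0" "\<delta> \<le> \<delta>0" using \<delta>0 \<epsilon> by (auto simp: \<delta>_def)
  have n\<delta>: "?n * \<delta> \<le> \<epsilon>"
  proof -
    have "?n * \<delta> \<le> (?n + 1) * (\<epsilon> / (?n + 1))"
      using \<delta>(1) by (intro mult_mono) (auto simp: \<delta>_def)
    then show ?thesis by simp
  qed
  let ?E = "\<lambda>N. {\<omega> \<in> space M.
    L2_set (\<lambda>a. ptilde N \<omega> a - pstar a) nonzero_attributes \<le> \<epsilon>}"
  show "(\<lambda>N. prob (?E N)) \<longlonglongrightarrow> 1"
  proof (rule prob_tendsto_1_superset[OF G[OF \<delta>(1)]])
    fix N :: nat assume N: "N \<ge> 1"
    show "?G \<delta> N \<subseteq> ?E N"
    proof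
      fix \<omega> assume \<omega>: "\<omega> \<in> ?G \<delta> N"
      then have space: "\<omega> \<in> space M" by blast
      have "Qarr N \<omega> = Q" using Qarr N space Qhat_equiv[OF N \<omega> \<delta>(2)] by blast
      then have min: "is_arg_min (\<lambda>p. (residual C (alpha N (\<lambda>r. R r \<omega>)) Q p)\<^sup>2)
          (\<lambda>p. p \<in> sub_probabilities) (ptilde N \<omega>)"
        using ptilde_min N space by metis
      have eq: "ptilde N \<omega> a = ?f N \<omega> a" if "a \<in> nonzero_attributes" for a
        by (rule minimizer_eq_empirical_freq[OF Q C1 C2 N _ _ min that])
          (use A R space in blast)+
      have "L2_set (\<lambda>a. ptilde N \<omega> a - pstar a) nonzero_attributes
          \<le> (\<Sum>a\<in>nonzero_attributes. \<bar>ptilde N \<omega> a - pstar a\<bar>)"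
        by (rule L2_set_le_sum_abs)
      also have "\<dots> \<le> (\<Sum>a\<in>(nonzero_attributes :: (nat ^ 'k) set). \<delta>)"
        by (rule sum_mono) (use \<omega> eq in \<open>auto simp: nonzero_attributes_def intro: less_imp_le\<close>)
      also have "\<dots> \<le> \<epsilon>" using n\<delta> by simp
      finally show "\<omega> \<in> ?E N" using space by simp
    qed
    have [measurable]: "(\<lambda>\<omega>. ptilde N \<omega> a) \<in> borel_measurable M" if "a \<in> nonzero_attributes" for a
      using ptilde_meas N that by blast
    have [measurable]: "(\<lambda>\<omega>. L2_set (\<lambda>a. ptilde N \<omega> a - pstar a) nonzero_attributes)
        \<in> borel_measurable M"
      unfolding L2_set_def by measurable
    show "?E N \<in> events" by measurable
  qed
qed

end
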